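(* Let $(X,\sigma)$ be a DR system. Then the nonwandering set $\Omega$, the wandering set $\mathfrak{W}$, and the closure $\overline{\mathfrak{W}}$ of $\mathfrak{W}$ in $X$ are all $(\sigma,\sigma^{-1})$-invariant sets.
   Context: A DR (Deaconu-Renault) system $(X,\sigma)$ consists of a locally compact Hausdorff space $X$ and a local homeomorphism $\sigma:\operatorname{Dom}(\sigma)\to\operatorname{Im}(\sigma)$ from an open set $\operatorname{Dom}(\sigma)\subseteq X$ onto an open set $\operatorname{Im}(\sigma)\subseteq X$. Iterates $\sigma^n$ are compositions of the partially defined map $\sigma$ on their natural domains $\operatorname{Dom}(\sigma^n)$, with $\sigma^0=\mathrm{id}$ and $\operatorname{Dom}(\sigma^0)=X$. For any $Y\subseteq X$ and $n\ge 0$, $\sigma^n(Y)$ means $\sigma^n(Y\cap\operatorname{Dom}(\sigma^n))$; for $k<0$, $\sigma^k(Y)=\{x\in\operatorname{Dom}(\sigma^{-k}):\sigma^{-k}(x)\in Y\}$. A subset $Y\subseteq X$ is $(\sigma,\sigma^{-1})$-invariant if $\sigma(Y)\subseteq Y$ and $\sigma^{-1}(Y)\subseteq Y$. A point $x\in X$ is wandering if there is an open neighborhood $U$ of $x$ with $\sigma^n(U)\cap\sigma^{-k}(\sigma^k(U))=\emptyset$ for all $n\ge1$ and all $k\in\mathbb{Z}$; otherwise $x$ is nonwandering. $\mathfrak{W}$ and $\Omega$ denote the sets of wandering and nonwandering points. *)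

theory Defs
  imports "HOL-Analysis.Analysis"
begin

definition local_homeomorphism_map :: "'a topology \<Rightarrow> 'b topology \<Rightarrow> ('a \<Rightarrow> 'b) \<Rightarrow> bool" where
  "local_homeomorphism_map X Y f \<longleftrightarrow>
     (\<forall>x \<in> topspace X. \<exists>U. x \<in> U \<and> openin X U \<and> openin Y (f ` U) \<and>
        homeomorphic_map (subtopology X U) (subtopology Y (f ` U)) f)"

text \<open>The partial map \<open>\<sigma>\<close> is encoded as a total function together with its domain \<open>D\<close>; the values
  of \<open>\<sigma>\<close> outside \<open>D\<close> are irrelevant, and \<open>\<sigma> ` D\<close> is the image of the partial map.\<close>

definition DR_system :: "'a topology \<Rightarrow> 'a set \<Rightarrow> ('a \<Rightarrow> 'a) \<Rightarrow> bool" where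
  "DR_system X D \<sigma> \<longleftrightarrow>
     locally_compact_space X \<and> Hausdorff_space X \<and>
     openin X D \<and> openin X (\<sigma> ` D) \<and>
     local_homeomorphism_map (subtopology X D) (subtopology X (\<sigma> ` D)) \<sigma>"

primrec iter_dom :: "'a topology \<Rightarrow> 'a set \<Rightarrow> ('a \<Rightarrow> 'a) \<Rightarrow> nat \<Rightarrow> 'a set" where
  "iter_dom X D \<sigma> 0 = topspace X"
| "iter_dom X D \<sigma> (Suc n) = {x \<in> iter_dom X D \<sigma> n. (\<sigma> ^^ n) x \<in> D}"

definition iter_set :: "'a topology \<Rightarrow> 'a set \<Rightarrow> ('a \<Rightarrow> 'a) \<Rightarrow> int \<Rightarrow> 'a set \<Rightarrow> 'a set" where
  "iter_set X D \<sigma> k Y =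
     (if k \<ge> 0 then (\<sigma> ^^ nat k) ` (Y \<inter> iter_dom X D \<sigma> (nat k))
      else {x \<in> iter_dom X D \<sigma> (nat (- k)). (\<sigma> ^^ nat (- k)) x \<in> Y})"

definition bi_invariant :: "'a topology \<Rightarrow> 'a set \<Rightarrow> ('a \<Rightarrow> 'a) \<Rightarrow> 'a set \<Rightarrow> bool" where
  "bi_invariant X D \<sigma> Y \<longleftrightarrow>
     Y \<subseteq> topspace X \<and> iter_set X D \<sigma> 1 Y \<subseteq> Y \<and> iter_set X D \<sigma> (- 1) Y \<subseteq> Y"

definition wandering_point :: "'a topology \<Rightarrow> 'a set \<Rightarrow> ('a \<Rightarrow> 'a) \<Rightarrow> 'a \<Rightarrow> bool" where
  "wandering_point X D \<sigma> x \<longleftrightarrow>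
     (\<exists>U. openin X U \<and> x \<in> U \<and>
        (\<forall>n\<ge>1. \<forall>k. iter_set X D \<sigma> n U \<inter> iter_set X D \<sigma> (- k) (iter_set X D \<sigma> k U) = {}))"

definition wandering_set :: "'a topology \<Rightarrow> 'a set \<Rightarrow> ('a \<Rightarrow> 'a) \<Rightarrow> 'a set" where
  "wandering_set X D \<sigma> = {x \<in> topspace X. wandering_point X D \<sigma> x}"

definition nonwandering_set :: "'a topology \<Rightarrow> 'a set \<Rightarrow> ('a \<Rightarrow> 'a) \<Rightarrow> 'a set" where
  "nonwandering_set X D \<sigma> = {x \<in> topspace X. \<not> wandering_point X D \<sigma> x}"

end

theory Submission
  imports Defs
begin

text \<open>
  Unravelled, a neighbourhood \<open>U\<close> witnesses that a point is wandering exactly when no two forward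
  orbits starting in \<open>U\<close> merge at different times: there are no \<open>u, v \<in> U\<close> and \<open>m > k\<close> with
  \<open>\<sigma>\<^sup>m(u) = \<sigma>\<^sup>k(v)\<close>. Here the case \<open>k \<ge> 0\<close> of the defining condition is this statement with
  \<open>m = n + k\<close>, while for \<open>k < 0\<close> the set \<open>\<sigma>\<^sup>-\<^sup>k(\<sigma>\<^sup>k(U))\<close> lies in \<open>U\<close>, so that case follows from
  \<open>k = 0\<close>.

  A set is \<open>(\<sigma>,\<sigma>\<^sup>-\<^sup>1)\<close>-invariant iff membership of \<open>x \<in> Dom(\<sigma>)\<close> and of \<open>\<sigma>(x)\<close> are equivalent.
  Merging at different times is insensitive to applying \<open>\<sigma>\<close> to both starting points, as it only
  shifts both times by one. Since \<open>\<sigma>\<close> is open and continuous on its open domain, witnessing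
  neighbourhoods can be pushed forward and pulled back along \<open>\<sigma>\<close>; so \<open>x\<close> is wandering iff \<open>\<sigma>(x)\<close>
  is. This is the invariance of the wandering set, and the equivalence passes to the complement.
  Openness and continuity also carry invariance from any set to its closure.
\<close>

section \<open>The shift map of a Deaconu-Renault system\<close>

lemma DR_system_dom_subset:
  assumes "DR_system X D \<sigma>"
  shows "D \<subseteq> topspace X"
  using assms by (auto simp: DR_system_def dest: openin_subset)

lemma DR_system_image_subset:
  assumes "DR_system X D \<sigma>"
  shows "\<sigma> ` D \<subseteq> topspace X"
  using assms by (auto simp: DR_system_def dest: openin_subset)

lemma local_homeomorphism_map_imp_open_map:
  assumes "local_homeomorphism_map X Y f"
  shows "open_map X Y f"
  unfolding open_map_def
proof (intro allI impI)
  fix W assume W: "openin X W"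
  show "openin Y (f ` W)"
  proof (subst openin_subopen, intro ballI)
    fix y assume "y \<in> f ` W"
    then obtain x where x: "x \<in> W" "y = f x" by auto
    moreover have "x \<in> topspace X" using W x openin_subset by blast
    ultimately obtain U where U: "x \<in> U" "openin X U" "openin Y (f ` U)"
      and hom: "homeomorphic_map (subtopology X U) (subtopology Y (f ` U)) f"
      using assms unfolding local_homeomorphism_map_def by blast
    have "openin (subtopology X U) (U \<inter> W)"
      using W by (simp add: openin_subtopology_Int2)
    then have "openin (subtopology Y (f ` U)) (f ` (U \<inter> W))"
      using hom homeomorphic_imp_open_map open_map_def by blast
    then have "openin Y (f ` (U \<inter> W))"
      using U(3) openin_trans_full by blast
    then show "\<exists>T. openin Y T \<and> y \<in> T \<and> T \<subseteq> f ` W"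
      using x U(1) by blast
  qed
qed

lemma local_homeomorphism_map_imp_continuous_map:
  assumes "local_homeomorphism_map X Y f"
  shows "continuous_map X Y f"
  unfolding continuous_map
proof (intro conjI allI impI)
  show "f ` topspace X \<subseteq> topspace Y"
  proof (intro image_subsetI)
    fix x assume "x \<in> topspace X"
    then obtain U where "x \<in> U" "openin Y (f ` U)"
      using assms unfolding local_homeomorphism_map_def by blast
    then show "f x \<in> topspace Y" using openin_subset by blast
  qed
next
  fix V assume V: "openin Y V"
  show "openin X {x \<in> topspace X. f x \<in> V}"
  proof (subst openin_subopen, intro ballI)
    fix x assume x: "x \<in> {x \<in> topspace X. f x \<in> V}"
    then obtain U where U: "x \<in> U" "openin X U"
      and hom: "homeomorphic_map (subtopology X U) (subtopology Y (f ` U)) f"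
      using assms unfolding local_homeomorphism_map_def by blast
    have "continuous_map (subtopology X U) Y f"
      using hom continuous_map_in_subtopology homeomorphic_imp_continuous_map by blast
    then have "openin (subtopology X U) {z \<in> topspace (subtopology X U). f z \<in> V}"
      using V by (rule openin_continuous_map_preimage)
    then have "openin X {z \<in> topspace (subtopology X U). f z \<in> V}"
      using U(2) openin_trans_full by blast
    then show "\<exists>T. openin X T \<and> x \<in> T \<and> T \<subseteq> {x \<in> topspace X. f x \<in> V}"
      using x U(1) by (intro exI[of _ "{z \<in> topspace (subtopology X U). f z \<in> V}"]) auto
  qed
qed

lemma DR_system_openin_image:
  assumes "DR_system X D \<sigma>" "openin X U" "U \<subseteq> D"
  shows "openin X (\<sigma> ` U)"
proof -
  have "openin (subtopology X D) U"
    using assms by (auto simp: openin_open_subtopology DR_system_def)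
  then have "openin (subtopology X (\<sigma> ` D)) (\<sigma> ` U)"
    using assms(1) local_homeomorphism_map_imp_open_map
    unfolding DR_system_def open_map_def by blast
  then show ?thesis
    using assms(1) unfolding DR_system_def by (meson openin_trans_full)
qed

lemma DR_system_openin_vimage:
  assumes "DR_system X D \<sigma>" "openin X V"
  shows "openin X {x \<in> D. \<sigma> x \<in> V}"
proof -
  have "continuous_map (subtopology X D) X \<sigma>"
    using assms(1) local_homeomorphism_map_imp_continuous_map
    unfolding DR_system_def by (metis continuous_map_in_subtopology)
  then have "openin (subtopology X D) {x \<in> topspace (subtopology X D). \<sigma> x \<in> V}"
    using assms(2) by (rule openin_continuous_map_preimage)
  moreover have "{x \<in> topspace (subtopology X D). \<sigma> x \<in> V} = {x \<in> D. \<sigma> x \<in> V}"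
    using DR_system_dom_subset[OF assms(1)] by auto
  moreover have "openin X D"
    using assms(1) by (simp add: DR_system_def)
  ultimately show ?thesis
    using openin_trans_full by metis
qed

section \<open>Domains of iterates and invariant sets\<close>

lemma funpow_mem_topspace:
  assumes "DR_system X D \<sigma>" "x \<in> iter_dom X D \<sigma> n"
  shows "(\<sigma> ^^ n) x \<in> topspace X"
  using assms DR_system_image_subset[OF assms(1)] by (cases n) auto

lemma iter_dom_add:
  assumes "DR_system X D \<sigma>"
  shows "x \<in> iter_dom X D \<sigma> (m + n) \<longleftrightarrow>
         x \<in> iter_dom X D \<sigma> n \<and> (\<sigma> ^^ n) x \<in> iter_dom X D \<sigma> m"
  using funpow_mem_topspace[OF assms] by (induction m) (auto simp: funpow_add)

lemma iter_dom_Suc_shift: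
  assumes "DR_system X D \<sigma>"
  shows "x \<in> iter_dom X D \<sigma> (Suc n) \<longleftrightarrow> x \<in> D \<and> \<sigma> x \<in> iter_dom X D \<sigma> n"
  using iter_dom_add[OF assms, of x n 1] DR_system_dom_subset[OF assms] by auto

lemma bi_invariant_iff:
  assumes "DR_system X D \<sigma>" "Y \<subseteq> topspace X"
  shows "bi_invariant X D \<sigma> Y \<longleftrightarrow> (\<forall>x\<in>D. \<sigma> x \<in> Y \<longleftrightarrow> x \<in> Y)"
  using assms(2) DR_system_dom_subset[OF assms(1)]
  unfolding bi_invariant_def iter_set_def by auto

lemma bi_invariant_complement:
  assumes "DR_system X D \<sigma>" "bi_invariant X D \<sigma> Y"
  shows "bi_invariant X D \<sigma> (topspace X - Y)"
proof -
  have "\<forall>x\<in>D. \<sigma> x \<in> Y \<longleftrightarrow> x \<in> Y"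
    using assms bi_invariant_iff unfolding bi_invariant_def by blast
  then show ?thesis
    using DR_system_dom_subset[OF assms(1)] DR_system_image_subset[OF assms(1)]
    by (subst bi_invariant_iff[OF assms(1)]) auto
qed

text \<open>Preimages and images of neighbourhoods are neighbourhoods, and invariance moves a point of
  \<open>Y\<close> found in one of them along \<open>\<sigma>\<close>, in either direction.\<close>

lemma bi_invariant_closure_of:
  assumes "DR_system X D \<sigma>" "bi_invariant X D \<sigma> Y"
  shows "bi_invariant X D \<sigma> (X closure_of Y)"
proof -
  have inv: "\<sigma> x \<in> Y \<longleftrightarrow> x \<in> Y" if "x \<in> D" for x
    using that assms bi_invariant_iff unfolding bi_invariant_def by blast
  have "\<sigma> x \<in> X closure_of Y \<longleftrightarrow> x \<in> X closure_of Y" if x: "x \<in> D" for x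
  proof
    assume cl: "\<sigma> x \<in> X closure_of Y"
    show "x \<in> X closure_of Y"
      unfolding in_closure_of
    proof (intro conjI allI impI)
      show "x \<in> topspace X" using x DR_system_dom_subset[OF assms(1)] by blast
    next
      fix U assume U: "x \<in> U \<and> openin X U"
      then have "openin X (U \<inter> D)"
        using assms(1) by (simp add: DR_system_def openin_Int)
      then have "openin X (\<sigma> ` (U \<inter> D))"
        using DR_system_openin_image[OF assms(1)] by blast
      moreover have "\<sigma> x \<in> \<sigma> ` (U \<inter> D)" using U x by blast
      ultimately obtain y where "y \<in> Y" "y \<in> \<sigma> ` (U \<inter> D)"
        using cl by (metis in_closure_of)
      then show "\<exists>y. y \<in> Y \<and> y \<in> U" using inv by blast
    qed
  next
    assume cl: "x \<in> X closure_of Y"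
    show "\<sigma> x \<in> X closure_of Y"
      unfolding in_closure_of
    proof (intro conjI allI impI)
      show "\<sigma> x \<in> topspace X" using x DR_system_image_subset[OF assms(1)] by blast
    next
      fix V assume V: "\<sigma> x \<in> V \<and> openin X V"
      define W where "W = {z \<in> D. \<sigma> z \<in> V}"
      have "openin X W"
        using DR_system_openin_vimage[OF assms(1)] V unfolding W_def by blast
      moreover have "x \<in> W" using x V by (simp add: W_def)
      ultimately obtain y where "y \<in> Y" "y \<in> W"
        using cl by (metis in_closure_of)
      then have "y \<in> Y" "y \<in> D" "\<sigma> y \<in> V" by (auto simp: W_def)
      then show "\<exists>y. y \<in> Y \<and> y \<in> V" using inv by blast
    qed
  qed
  then show ?thesis
    by (subst bi_invariant_iff[OF assms(1)]) (auto simp: closure_of_subset_topspace)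
qed

section \<open>Wandering points\<close>

definition merge_free :: "'a topology \<Rightarrow> 'a set \<Rightarrow> ('a \<Rightarrow> 'a) \<Rightarrow> 'a set \<Rightarrow> bool" where
  "merge_free X D \<sigma> U \<longleftrightarrow>
     (\<forall>u\<in>U. \<forall>v\<in>U. \<forall>m k. k < m \<longrightarrow> u \<in> iter_dom X D \<sigma> m \<longrightarrow> v \<in> iter_dom X D \<sigma> k \<longrightarrow>
        (\<sigma> ^^ m) u \<noteq> (\<sigma> ^^ k) v)"

lemma merge_free_subset:
  assumes "merge_free X D \<sigma> V" "U \<subseteq> V"
  shows "merge_free X D \<sigma> U"
  using assms unfolding merge_free_def by blast

lemma merge_free_iff_disjoint_iterates:
  assumes "DR_system X D \<sigma>" "U \<subseteq> topspace X"
  shows "merge_free X D \<sigma> U \<longleftrightarrow>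
    (\<forall>n\<ge>1. \<forall>k. iter_set X D \<sigma> n U \<inter> iter_set X D \<sigma> (- k) (iter_set X D \<sigma> k U) = {})"
    (is "_ \<longleftrightarrow> (\<forall>n\<ge>1. \<forall>k. ?A n \<inter> ?B k = {})")
proof
  assume free: "merge_free X D \<sigma> U"
  show "\<forall>n\<ge>1. \<forall>k. ?A n \<inter> ?B k = {}"
  proof (intro allI impI equals0I)
    fix n k :: int and y
    assume n: "1 \<le> n" and y: "y \<in> ?A n \<inter> ?B k"
    from n have "nat n > 0" by simp
    from y n obtain u where u: "u \<in> U" "u \<in> iter_dom X D \<sigma> (nat n)" "y = (\<sigma> ^^ nat n) u"
      unfolding iter_set_def by auto
    show False
    proof (cases "k > 0")
      case True
      with y obtain v where v: "v \<in> U" "v \<in> iter_dom X D \<sigma> (nat k)"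
        "y \<in> iter_dom X D \<sigma> (nat k)" "(\<sigma> ^^ nat k) y = (\<sigma> ^^ nat k) v"
        unfolding iter_set_def by auto
      have "u \<in> iter_dom X D \<sigma> (nat k + nat n)"
        using u v iter_dom_add[OF assms(1)] by blast
      moreover have "(\<sigma> ^^ (nat k + nat n)) u = (\<sigma> ^^ nat k) v"
        using u v by (simp add: funpow_add)
      ultimately show False
        using free u v \<open>nat n > 0\<close> unfolding merge_free_def by (metis less_add_same_cancel1)
    next
      case False
      then have "y \<in> U"
        using y unfolding iter_set_def by (auto split: if_splits)
      moreover from this have "y \<in> iter_dom X D \<sigma> 0" using assms(2) by auto
      ultimately show False
        using free u \<open>nat n > 0\<close> unfolding merge_free_def by (metis funpow_0)
    qed
  qed
next
  assume disj: "\<forall>n\<ge>1. \<forall>k. ?A n \<inter> ?B k = {}"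
  show "merge_free X D \<sigma> U"
    unfolding merge_free_def
  proof (intro ballI allI impI notI)
    fix u v and m k :: nat
    assume uv: "u \<in> U" "v \<in> U" "k < m" "u \<in> iter_dom X D \<sigma> m" "v \<in> iter_dom X D \<sigma> k"
      and eq: "(\<sigma> ^^ m) u = (\<sigma> ^^ k) v"
    define n where "n = m - k"
    have n: "m = k + n" "n \<ge> 1" using uv(3) by (auto simp: n_def)
    let ?y = "(\<sigma> ^^ n) u"
    have dom: "u \<in> iter_dom X D \<sigma> n" "?y \<in> iter_dom X D \<sigma> k"
      using uv(4) iter_dom_add[OF assms(1)] n(1) by blast+
    have "(\<sigma> ^^ k) ?y = (\<sigma> ^^ k) v" using eq n(1) by (simp add: funpow_add)
    then have "?y \<in> ?B (int k)"
      using dom uv unfolding iter_set_def by auto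
    moreover have "?y \<in> ?A (int n)"
      using dom uv unfolding iter_set_def by auto
    ultimately show False using disj n(2) by (metis disjoint_iff of_nat_1 of_nat_mono)
  qed
qed

lemma wandering_point_iff_merge_free:
  assumes "DR_system X D \<sigma>"
  shows "wandering_point X D \<sigma> x \<longleftrightarrow> (\<exists>U. openin X U \<and> x \<in> U \<and> merge_free X D \<sigma> U)"
  unfolding wandering_point_def
  using merge_free_iff_disjoint_iterates[OF assms] openin_subset by metis

text \<open>Merging of \<open>u\<close> and \<open>v\<close> at times \<open>m > k\<close> corresponds to merging of \<open>\<sigma>(u)\<close> and \<open>\<sigma>(v)\<close> at times
  \<open>m - 1 > k - 1\<close>. If \<open>k = 0\<close>, so that \<open>v\<close> itself is \<open>\<sigma>\<^sup>m(u)\<close>, one first continues both orbits by one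
  step, which is possible because \<open>v\<close> lies in the domain.\<close>

lemma merge_free_image_iff:
  assumes "DR_system X D \<sigma>" "U \<subseteq> D"
  shows "merge_free X D \<sigma> (\<sigma> ` U) \<longleftrightarrow> merge_free X D \<sigma> U"
proof
  assume free: "merge_free X D \<sigma> U"
  show "merge_free X D \<sigma> (\<sigma> ` U)"
    unfolding merge_free_def
  proof (intro ballI allI impI notI)
    fix u' v' and m k :: nat
    assume "u' \<in> \<sigma> ` U" "v' \<in> \<sigma> ` U" and *: "k < m" "u' \<in> iter_dom X D \<sigma> m"
      "v' \<in> iter_dom X D \<sigma> k" "(\<sigma> ^^ m) u' = (\<sigma> ^^ k) v'"
    then obtain u v where uv: "u \<in> U" "v \<in> U" "u' = \<sigma> u" "v' = \<sigma> v" by blast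
    have "u \<in> iter_dom X D \<sigma> (Suc m)" "v \<in> iter_dom X D \<sigma> (Suc k)"
      using uv * assms(2) iter_dom_Suc_shift[OF assms(1)] by blast+
    moreover have "(\<sigma> ^^ Suc m) u = (\<sigma> ^^ Suc k) v"
      using uv * by (simp add: funpow_swap1)
    ultimately show False
      using free uv *(1) unfolding merge_free_def by (meson Suc_mono)
  qed
next
  assume free: "merge_free X D \<sigma> (\<sigma> ` U)"
  have no_merge: False
    if "u \<in> U" "v \<in> U" "k < m" "u \<in> iter_dom X D \<sigma> (Suc m)" "v \<in> iter_dom X D \<sigma> (Suc k)"
      "(\<sigma> ^^ Suc m) u = (\<sigma> ^^ Suc k) v" for u v and m k :: nat
  proof -
    have "\<sigma> u \<in> iter_dom X D \<sigma> m" "\<sigma> v \<in> iter_dom X D \<sigma> k"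
      using that iter_dom_Suc_shift[OF assms(1)] by blast+
    moreover have "(\<sigma> ^^ m) (\<sigma> u) = (\<sigma> ^^ k) (\<sigma> v)"
      using that(6) by (simp add: funpow_swap1)
    ultimately show False
      using free that(1-3) unfolding merge_free_def by blast
  qed
  show "merge_free X D \<sigma> U"
    unfolding merge_free_def
  proof (intro ballI allI impI notI)
    fix u v and m k :: nat
    assume uv: "u \<in> U" "v \<in> U" "k < m" "u \<in> iter_dom X D \<sigma> m" "v \<in> iter_dom X D \<sigma> k"
      "(\<sigma> ^^ m) u = (\<sigma> ^^ k) v"
    show False
    proof (cases k)
      case 0
      then have eq: "(\<sigma> ^^ m) u = v" using uv by simp
      have "v \<in> D" using uv assms(2) by blast
      then have "u \<in> iter_dom X D \<sigma> (Suc m)" "v \<in> iter_dom X D \<sigma> (Suc 0)"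
        using uv 0 eq by auto
      moreover have "(\<sigma> ^^ Suc m) u = (\<sigma> ^^ Suc 0) v" using eq by simp
      ultimately show False using no_merge uv 0 by blast
    next
      case (Suc k')
      moreover obtain m' where "m = Suc m'" using uv(3) by (cases m) auto
      ultimately show False using no_merge uv by blast
    qed
  qed
qed

lemma wandering_point_shift_iff:
  assumes "DR_system X D \<sigma>" "x \<in> D"
  shows "wandering_point X D \<sigma> (\<sigma> x) \<longleftrightarrow> wandering_point X D \<sigma> x"
proof
  assume "wandering_point X D \<sigma> (\<sigma> x)"
  then obtain V where V: "openin X V" "\<sigma> x \<in> V" "merge_free X D \<sigma> V"
    using wandering_point_iff_merge_free[OF assms(1)] by blast
  let ?U = "{z \<in> D. \<sigma> z \<in> V}"
  have "merge_free X D \<sigma> (\<sigma> ` ?U)"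
    using V(3) by (rule merge_free_subset) blast
  then have "merge_free X D \<sigma> ?U"
    by (subst (asm) merge_free_image_iff[OF assms(1)]) blast+
  moreover have "openin X ?U" "x \<in> ?U"
    using DR_system_openin_vimage[OF assms(1) V(1)] V(2) assms(2) by blast+
  ultimately show "wandering_point X D \<sigma> x"
    using wandering_point_iff_merge_free[OF assms(1)] by blast
next
  assume "wandering_point X D \<sigma> x"
  then obtain U where U: "openin X U" "x \<in> U" "merge_free X D \<sigma> U"
    using wandering_point_iff_merge_free[OF assms(1)] by blast
  have "merge_free X D \<sigma> (U \<inter> D)"
    using U(3) by (rule merge_free_subset) blast
  then have "merge_free X D \<sigma> (\<sigma> ` (U \<inter> D))"
    by (subst merge_free_image_iff[OF assms(1)]) blast+
  moreover have "openin X (\<sigma> ` (U \<inter> D))"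
    using assms(1) U(1)
    by (intro DR_system_openin_image[OF assms(1)]) (auto simp: DR_system_def openin_Int)
  moreover have "\<sigma> x \<in> \<sigma> ` (U \<inter> D)" using U(2) assms(2) by blast
  ultimately show "wandering_point X D \<sigma> (\<sigma> x)"
    using wandering_point_iff_merge_free[OF assms(1)] by blast
qed

lemma bi_invariant_wandering_set:
  assumes "DR_system X D \<sigma>"
  shows "bi_invariant X D \<sigma> (wandering_set X D \<sigma>)"
  using wandering_point_shift_iff[OF assms] DR_system_dom_subset[OF assms]
    DR_system_image_subset[OF assms]
  by (subst bi_invariant_iff[OF assms]) (auto simp: wandering_set_def)

theorem proposition3p8:
  fixes X :: "'a topology" and D :: "'a set" and \<sigma> :: "'a \<Rightarrow> 'a"
  assumes "DR_system X D \<sigma>"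
  shows "bi_invariant X D \<sigma> (nonwandering_set X D \<sigma>) \<and>
         bi_invariant X D \<sigma> (wandering_set X D \<sigma>) \<and>
         bi_invariant X D \<sigma> (X closure_of (wandering_set X D \<sigma>))"
proof -
  have "nonwandering_set X D \<sigma> = topspace X - wandering_set X D \<sigma>"
    by (auto simp: nonwandering_set_def wandering_set_def)
  then show ?thesis
    using bi_invariant_wandering_set[OF assms] bi_invariant_complement[OF assms]
      bi_invariant_closure_of[OF assms] by simp
qed

end
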